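(* Let $\varphi$ and $\psi$ be linear fractional self-maps of $\mathbb{D}$ and let $f$ be a non-constant self-map of $\mathbb{D}$. Assume that $f\circ\varphi=\psi\circ f$ on $\mathbb{D}$. Then: (a) If $\varphi=\mathrm{id}_{\mathbb{D}}$, then $\psi=\mathrm{id}_{\mathbb{D}}$. (b) If $\psi=\mathrm{id}_{\mathbb{D}}$ and $\varphi\neq \mathrm{id}_{\mathbb{D}}$, $p$ is the Denjoy-Wolff point of $\varphi$, and the angular limit $\angle\lim_{z\to p}f(z)$ exists, then $\varphi$ is either a rational elliptic automorphism or a parabolic automorphism.
   Context: $\mathbb{D}$ is the open unit disk in $\mathbb{C}$; $\mathrm{id}_{\mathbb{D}}$ is the identity map of $\mathbb{D}$. A self-map of $\mathbb{D}$ is a function analytic in $\mathbb{D}$ with $f(\mathbb{D})\subset\mathbb{D}$. A linear fractional self-map is a self-map of $\mathbb{D}$ of the form $z\mapsto (az+b)/(cz+d)$ with $ad-bc\ne0$. An automorphism is a bijective self-map of $\mathbb{D}$. The symbol $\angle\lim$ denotes the angular (non-tangential) limit; if $p\in\mathbb{D}$, the limit is the ordinary one (and automatically exists). Denjoy-Wolff point of a non-identity self-map $g$ of $\mathbb{D}$: if $g$ has a fixed point in $\mathbb{D}$ (necessarily unique), it is that point (also when $g$ is an automorphism), and $g$ is called elliptic; otherwise it is the unique point $p\in\partial\mathbb{D}$ to which the iterates of $g$ converge uniformly on compact subsets of $\mathbb{D}$, and then $g$ is called parabolic if its (angular) derivative satisfies $g'(p)=1$ and hyperbolic if $g'(p)<1$.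 A rational elliptic automorphism is an elliptic automorphism conjugate (by a disk automorphism) to a rotation $R_\lambda(z)=\lambda z$, where $\lambda^n=1$ for some positive integer $n$. *)

theory Defs
  imports "HOL-Complex_Analysis.Complex_Analysis"
begin

text \<open>
  Maps of the unit disk are total functions of which only the values on the disk matter;
  equality of maps is equality on the disk.
\<close>

abbreviation unit_disk :: "complex set" where
  "unit_disk \<equiv> ball 0 1"

abbreviation id_on_disk :: "(complex \<Rightarrow> complex) \<Rightarrow> bool" where
  "id_on_disk g \<equiv> (\<forall>z\<in>unit_disk. g z = z)"

definition self_map :: "(complex \<Rightarrow> complex) \<Rightarrow> bool" where
  "self_map g \<longleftrightarrow> g holomorphic_on unit_disk \<and> g ` unit_disk \<subseteq> unit_disk"

text \<open>
  The condition \<open>c * z + d \<noteq> 0\<close> only rules out accidental values coming from division by zero.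
\<close>

definition linear_fractional_self_map :: "(complex \<Rightarrow> complex) \<Rightarrow> bool" where
  "linear_fractional_self_map g \<longleftrightarrow>
     self_map g \<and>
     (\<exists>a b c d. a * d - b * c \<noteq> 0 \<and>
        (\<forall>z\<in>unit_disk. c * z + d \<noteq> 0 \<and> g z = (a * z + b) / (c * z + d)))"

definition disk_automorphism :: "(complex \<Rightarrow> complex) \<Rightarrow> bool" where
  "disk_automorphism g \<longleftrightarrow> self_map g \<and> bij_betw g unit_disk unit_disk"

text \<open>
  Non-tangential approach to a boundary point \<open>p\<close> means approach within some Stolz region at \<open>p\<close>.
\<close>

definition stolz_region :: "complex \<Rightarrow> real \<Rightarrow> complex set" where
  "stolz_region p M = {z \<in> unit_disk. norm (z - p) < M * (1 - norm z)}"

definition has_angular_limit :: "(complex \<Rightarrow> complex) \<Rightarrow> complex \<Rightarrow> complex \<Rightarrow> bool" where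
  "has_angular_limit f p L \<longleftrightarrow>
     (p \<in> unit_disk \<and> (f \<longlongrightarrow> L) (at p)) \<or>
     (p \<in> sphere 0 1 \<and> (\<forall>M>1. (f \<longlongrightarrow> L) (at p within stolz_region p M)))"

text \<open>
  In the next definition \<open>w\<close> is the angular limit of \<open>f\<close> at \<open>p\<close>, playing the role of \<open>f(p)\<close>.
\<close>

definition has_angular_derivative :: "(complex \<Rightarrow> complex) \<Rightarrow> complex \<Rightarrow> complex \<Rightarrow> bool" where
  "has_angular_derivative f p D \<longleftrightarrow>
     (\<exists>w. has_angular_limit f p w \<and> has_angular_limit (\<lambda>z. (f z - w) / (z - p)) p D)"

definition denjoy_wolff_point :: "(complex \<Rightarrow> complex) \<Rightarrow> complex \<Rightarrow> bool" where
  "denjoy_wolff_point g p \<longleftrightarrow>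
     self_map g \<and> \<not> id_on_disk g \<and>
     (if \<exists>z\<in>unit_disk. g z = z
      then p \<in> unit_disk \<and> g p = p
      else p \<in> sphere 0 1 \<and>
           (\<forall>K. compact K \<and> K \<subseteq> unit_disk \<longrightarrow>
              uniform_limit K (\<lambda>n. g ^^ n) (\<lambda>_. p) sequentially))"

definition elliptic :: "(complex \<Rightarrow> complex) \<Rightarrow> bool" where
  "elliptic g \<longleftrightarrow> self_map g \<and> \<not> id_on_disk g \<and> (\<exists>z\<in>unit_disk. g z = z)"

definition parabolic :: "(complex \<Rightarrow> complex) \<Rightarrow> bool" where
  "parabolic g \<longleftrightarrow>
     (\<exists>p\<in>sphere 0 1. denjoy_wolff_point g p \<and> has_angular_derivative g p 1)"

text \<open>
  Since \<open>h\<close> is a bijection of the disk, the equation below says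
  \<open>g = h\<inverse> \<circ> r \<circ> h\<close> on the disk.
\<close>

definition disk_conjugate :: "(complex \<Rightarrow> complex) \<Rightarrow> (complex \<Rightarrow> complex) \<Rightarrow> bool" where
  "disk_conjugate g r \<longleftrightarrow>
     (\<exists>h. disk_automorphism h \<and> (\<forall>z\<in>unit_disk. h (g z) = r (h z)))"

definition rational_elliptic_automorphism :: "(complex \<Rightarrow> complex) \<Rightarrow> bool" where
  "rational_elliptic_automorphism g \<longleftrightarrow>
     disk_automorphism g \<and> elliptic g \<and>
     (\<exists>u n. n > (0::nat) \<and> u ^ n = 1 \<and> disk_conjugate g (\<lambda>z. u * z))"

end

theory Submission
  imports Defs
begin

text \<open>
  Part (a) is the identity theorem: \<open>\<psi>\<close> fixes every point of \<open>f(D)\<close>, which is open because \<open>f\<close> is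
  not constant.

  In part (b) the hypothesis reads \<open>f \<circ> \<phi> = f\<close>, so \<open>f\<close> is constant along the orbits of \<open>\<phi>\<close>, and
  the orbits tend to the Denjoy--Wolff point \<open>p\<close>.

  If \<open>p\<close> lies in the disk, comparing the leading terms of \<open>f \<circ> \<phi> - f(p)\<close> and \<open>f - f(p)\<close> at \<open>p\<close>
  shows that \<open>\<phi>'(p)\<close> is a root of unity (\<open>multiplier_root_of_unity\<close>).  After moving \<open>p\<close> to the
  origin, the equality case of the Schwarz lemma turns \<open>\<phi>\<close> into a rotation
  (\<open>interior_fixed_point_rational_elliptic\<close>).

  If \<open>p\<close> lies on the circle, the Cayley transform \<open>w = (p + z) / (p - z)\<close> carries the disk to the
  right half-plane and \<open>p\<close> to infinity, and \<open>\<phi>\<close> becomes an affine map \<open>w \<mapsto> a w + B\<close> with \<open>a \<ge> 0\<close>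
  real and \<open>Re B \<ge> 0\<close> (\<open>boundary_fixed_point_affine\<close>).  For \<open>a < 1\<close> its orbits stay bounded, so
  they do not tend to infinity.  For \<open>a > 1\<close>, or \<open>a = 1\<close> and \<open>Re B > 0\<close>, every orbit stays in a
  sector, that is, it approaches \<open>p\<close> inside one Stolz region (\<open>affine_orbit_in_sector\<close>); then \<open>f\<close>
  equals its angular limit at every point, and is constant.  The remaining maps \<open>w \<mapsto> w + B\<close> with
  \<open>B\<close> imaginary are the parabolic automorphisms.
\<close>

section \<open>Fixed points in the disk\<close>

text \<open>
  If \<open>f - f \<xi>\<close> has leading term \<open>c (z - \<xi>)^n\<close>, then \<open>f \<circ> g - f \<xi>\<close> has leading term
  \<open>c (g'(\<xi>))^n (z - \<xi>)^n\<close>.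
\<close>

lemma multiplier_root_of_unity:
  assumes f: "f holomorphic_on S" and g: "g holomorphic_on S"
    and S: "open S" "connected S" "\<xi> \<in> S"
    and fix_\<xi>: "g \<xi> = \<xi>"
    and nonconst: "\<not> f constant_on S"
    and inv: "\<And>z. z \<in> S \<Longrightarrow> f (g z) = f z"
  obtains n where "n > 0" "deriv g \<xi> ^ n = 1"
proof -
  have nonconst': "\<not> (\<lambda>z. f z - f \<xi>) constant_on S"
    using nonconst unfolding constant_on_def by (metis diff_add_cancel)
  have hol: "(\<lambda>z. f z - f \<xi>) holomorphic_on S"
    by (intro holomorphic_intros f)
  obtain G r n where n: "0 < n" and r: "0 < r" "ball \<xi> r \<subseteq> S"
    and G: "G holomorphic_on ball \<xi> r"
    and eq: "\<And>w. w \<in> ball \<xi> r \<Longrightarrow> f w - f \<xi> = (w - \<xi>) ^ n * G w"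
    and nz: "\<And>w. w \<in> ball \<xi> r \<Longrightarrow> G w \<noteq> 0"
    by (rule holomorphic_factor_zero_nonconstant[OF hol S _ nonconst']) (simp, blast)
  have contG: "isCont G \<xi>"
    by (rule continuous_on_interior[OF holomorphic_on_imp_continuous_on[OF G]]) (use r(1) in simp)
  have derg: "(g has_field_derivative deriv g \<xi>) (at \<xi>)"
    using g S holomorphic_derivI by blast
  have limg: "g \<midarrow>\<xi>\<rightarrow> \<xi>"
    using DERIV_isCont[OF derg] fix_\<xi> by (simp add: isCont_def)
  have quot: "((\<lambda>z. (g z - \<xi>) / (z - \<xi>)) \<longlongrightarrow> deriv g \<xi>) (at \<xi>)"
    using derg fix_\<xi> by (simp add: has_field_derivative_iff)
  have contGg: "((\<lambda>z. G (g z)) \<longlongrightarrow> G \<xi>) (at \<xi>)"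
    by (rule isCont_tendsto_compose[OF contG limg])
  have lim1: "((\<lambda>z. ((g z - \<xi>) / (z - \<xi>)) ^ n * G (g z)) \<longlongrightarrow> deriv g \<xi> ^ n * G \<xi>) (at \<xi>)"
    by (intro tendsto_intros quot contGg)
  have ev1: "eventually (\<lambda>z. z \<in> ball \<xi> r \<and> z \<noteq> \<xi>) (at \<xi>)"
    using r(1) by (auto simp: eventually_at_filter eventually_nhds
        intro!: exI[of _ "ball \<xi> r"])
  have ev2: "eventually (\<lambda>z. g z \<in> ball \<xi> r) (at \<xi>)"
    using limg r(1) topological_tendstoD[of g \<xi> "at \<xi>" "ball \<xi> r"] by auto
  have "eventually (\<lambda>z. ((g z - \<xi>) / (z - \<xi>)) ^ n * G (g z) = G z) (at \<xi>)"
    using ev1 ev2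
  proof eventually_elim
    case (elim z)
    have "(g z - \<xi>) ^ n * G (g z) = (z - \<xi>) ^ n * G z"
      using eq[of z] eq[of "g z"] inv[of z] elim r(2) by auto
    then show ?case using elim by (simp add: power_divide field_simps)
  qed
  then have "(G \<longlongrightarrow> deriv g \<xi> ^ n * G \<xi>) (at \<xi>)"
    using lim1 tendsto_cong by fast
  then have "deriv g \<xi> ^ n * G \<xi> = G \<xi>"
    by (rule LIM_unique[OF _ isContD[OF contG]])
  then have "deriv g \<xi> ^ n = 1" using nz[of \<xi>] r(1) by simp
  with n show ?thesis by (rule that)
qed

lemma interior_fixed_point_rational_elliptic:
  assumes \<phi>: "self_map \<phi>" and notid: "\<not> id_on_disk \<phi>"
    and p: "p \<in> unit_disk" "\<phi> p = p"
    and f: "f holomorphic_on unit_disk" "\<not> f constant_on unit_disk"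
    and inv: "\<And>z. z \<in> unit_disk \<Longrightarrow> f (\<phi> z) = f z"
  shows "rational_elliptic_automorphism \<phi>"
proof -
  obtain h k where h: "h p = 0" "h holomorphic_on unit_disk" "h ` unit_disk \<subseteq> unit_disk"
    and k: "k holomorphic_on unit_disk" "k ` unit_disk \<subseteq> unit_disk"
    and hk: "\<And>z. z \<in> unit_disk \<Longrightarrow> h (k z) = z" and kh: "\<And>z. z \<in> unit_disk \<Longrightarrow> k (h z) = z"
    using ball_biholomorphism_exists[OF p(1)] by metis
  have \<phi>_hol: "\<phi> holomorphic_on unit_disk" and \<phi>_in: "\<phi> ` unit_disk \<subseteq> unit_disk"
    using \<phi> by (auto simp: self_map_def)
  have h_in: "h z \<in> unit_disk" and k_in: "k z \<in> unit_disk" and f_in: "\<phi> z \<in> unit_disk"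
    if "z \<in> unit_disk" for z
    using that h(3) k(2) \<phi>_in by blast+
  define g where "g = (\<lambda>z. h (\<phi> (k z)))"
  have k0: "k 0 = p" using kh[OF p(1)] h(1) by simp
  have g0: "g 0 = 0" by (simp add: g_def k0 p h)
  have "(\<phi> \<circ> k) holomorphic_on unit_disk"
    by (rule holomorphic_on_compose_gen[OF k(1) \<phi>_hol k(2)])
  then have "(h \<circ> (\<phi> \<circ> k)) holomorphic_on unit_disk"
    by (rule holomorphic_on_compose_gen[OF _ h(2)]) (use k_in f_in in \<open>auto simp del: mem_ball_0\<close>)
  then have g_hol: "g holomorphic_on unit_disk"
    by (simp add: g_def o_def)
  have g_in: "g z \<in> unit_disk" if "z \<in> unit_disk" for z
    unfolding g_def by (intro h_in f_in k_in that)
  have F_hol: "(\<lambda>z. f (k z)) holomorphic_on unit_disk"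
    using holomorphic_on_compose_gen[OF k(1) f(1) k(2)] by (simp add: o_def)
  have "\<not> (\<lambda>z. f (k z)) constant_on unit_disk"
    using f(2) h_in kh unfolding constant_on_def by metis
  then obtain m where m: "m > 0" "deriv g 0 ^ m = 1"
    using multiplier_root_of_unity[OF F_hol g_hol, of 0] g0 inv k_in kh f_in
    by (auto simp: g_def)
  then have "norm (deriv g 0) = 1"
    using power_eq_1_iff by blast
  then obtain u where u: "\<And>z. norm z < 1 \<Longrightarrow> g z = u * z" and nu: "norm u = 1"
    using Schwarz_Lemma(3)[OF g_hol g0, of 0] g_in by auto
  have "deriv g 0 = deriv (\<lambda>z. u * z) 0"
    by (rule deriv_cong_ev)
      (use u in \<open>auto simp: eventually_nhds intro!: exI[of _ unit_disk]\<close>)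
  then have um: "u ^ m = 1" using m by simp
  have conj: "h (\<phi> z) = u * h z" if "z \<in> unit_disk" for z
    using u[of "h z"] h_in[OF that] kh[OF that] by (simp add: g_def)
  have "bij_betw \<phi> unit_disk unit_disk"
    unfolding bij_betw_def
  proof
    show "inj_on \<phi> unit_disk"
    proof (rule inj_onI)
      fix x y assume xy: "x \<in> unit_disk" "y \<in> unit_disk" "\<phi> x = \<phi> y"
      then have "h x = h y" using conj[of x] conj[of y] nu by force
      then show "x = y" using kh xy by metis
    qed
    show "\<phi> ` unit_disk = unit_disk"
    proof
      show "unit_disk \<subseteq> \<phi> ` unit_disk"
      proof
        fix y assume y: "y \<in> unit_disk"
        let ?x = "k (h y / u)"
        have hyu: "h y / u \<in> unit_disk" using h_in[OF y] nu by (simp add: norm_divide)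
        then have x: "?x \<in> unit_disk" by (rule k_in)
        have "h (\<phi> ?x) = h y" using conj[OF x] hk[OF hyu] nu by force
        then have "\<phi> ?x = y" using kh f_in[OF x] y by metis
        then show "y \<in> \<phi> ` unit_disk" using x by (metis image_eqI)
      qed
    qed (fact \<phi>_in)
  qed
  moreover have "bij_betw h unit_disk unit_disk"
    by (rule bij_betw_byWitness[of _ k]) (use hk kh h k in auto)
  ultimately show ?thesis
    unfolding rational_elliptic_automorphism_def disk_automorphism_def elliptic_def
      disk_conjugate_def self_map_def
    using \<phi>_hol \<phi>_in notid p m(1) um h conj by blast
qed

section \<open>The Cayley transform at a boundary point\<close>

definition cayley :: "complex \<Rightarrow> complex \<Rightarrow> complex" where
  "cayley p z = (p + z) / (p - z)"

lemma Re_cayley: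
  assumes "norm p = 1"
  shows "Re (cayley p z) = (1 - norm z ^ 2) / norm (p - z) ^ 2"
proof -
  have "Re ((p + z) * cnj (p - z)) = norm p ^ 2 - norm z ^ 2"
    unfolding cmod_power2 by (simp add: algebra_simps power2_eq_square)
  then have "Re (cayley p z) = (norm p ^ 2 - norm z ^ 2) / norm (p - z) ^ 2"
    unfolding cayley_def by (subst complex_div_cnj) (simp del: complex_cnj_diff flip: of_real_power)
  then show ?thesis using assms by simp
qed

lemma cayley_plus_1: "z \<noteq> p \<Longrightarrow> cayley p z + 1 = 2 * p / (p - z)"
  by (simp add: cayley_def field_simps)

lemma unit_disk_neq_boundary: "norm p = 1 \<Longrightarrow> z \<in> unit_disk \<Longrightarrow> z \<noteq> p"
  by auto

lemma Re_cayley_pos: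
  assumes "norm p = 1" "z \<in> unit_disk"
  shows "Re (cayley p z) > 0"
  using assms unit_disk_neq_boundary[OF assms]
  by (auto simp: Re_cayley power_less_one_iff abs_square_less_1)

lemma cayley_inj:
  assumes "norm p = 1" "z \<in> unit_disk" "z' \<in> unit_disk" "cayley p z = cayley p z'"
  shows "z = z'"
proof -
  have "2 * p / (p - z) = 2 * p / (p - z')"
    using assms cayley_plus_1 unit_disk_neq_boundary by metis
  then show ?thesis
    using assms unit_disk_neq_boundary[of p] by (auto simp: field_simps)
qed

lemma cayley_surj:
  assumes p: "norm p = 1" and w: "Re w > 0"
  obtains z where "z \<in> unit_disk" "cayley p z = w"
proof
  let ?z = "p * ((w - 1) / (w + 1))"
  have p0: "p \<noteq> 0" using p by auto
  have w1: "w + 1 \<noteq> 0" using w by (auto simp: complex_eq_iff)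
  have "norm (w - 1) ^ 2 < norm (w + 1) ^ 2"
    using w unfolding cmod_power2 by (simp add: power2_eq_square algebra_simps)
  then have "norm (w - 1) < norm (w + 1)"
    using power_less_imp_less_base norm_ge_zero by blast
  then show "?z \<in> unit_disk"
    using p w1 by (simp add: norm_mult norm_divide)
  have "p + ?z = p * (2 * w / (w + 1))" "p - ?z = p * (2 / (w + 1))"
    using w1 by (simp_all add: field_simps)
  then show "cayley p ?z = w" using p0 w1 by (simp add: cayley_def)
qed

text \<open>
  Sectors in the right half-plane correspond to Stolz regions: the quotient
  \<open>\<bar>w + 1\<bar> / Re w\<close> equals \<open>2 \<bar>z - p\<bar> / (1 - \<bar>z\<bar>\<^sup>2)\<close>.
\<close>

lemma sector_imp_stolz:
  assumes p: "norm p = 1" and z: "z \<in> unit_disk"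
    and sector: "norm (cayley p z + 1) < M * Re (cayley p z)"
  shows "z \<in> stolz_region p M"
proof -
  have zp: "norm (p - z) > 0" using unit_disk_neq_boundary[OF p z] by auto
  have n1: "norm z < 1" using z by simp
  have "norm (cayley p z + 1) = 2 / norm (p - z)"
    using unit_disk_neq_boundary[OF p z] p by (simp add: cayley_plus_1 norm_divide norm_mult)
  then have "2 / norm (p - z) < M * ((1 - norm z ^ 2) / norm (p - z) ^ 2)"
    using sector Re_cayley[OF p] by metis
  then have main: "2 * norm (p - z) < M * (1 - norm z ^ 2)"
    using zp by (simp add: field_simps power2_eq_square)
  have "M > 0"
    using sector Re_cayley_pos[OF p z] by (meson norm_ge_zero order_le_less_trans zero_less_mult_pos2)
  moreover have "1 - norm z ^ 2 \<le> 2 * (1 - norm z)"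
    using zero_le_power2[of "1 - norm z"] by (simp add: power2_eq_square algebra_simps)
  ultimately have "M * (1 - norm z ^ 2) \<le> M * (2 * (1 - norm z))" by simp
  also have "\<dots> = 2 * (M * (1 - norm z))" by simp
  finally have "norm (z - p) < M * (1 - norm z)" using main by (simp add: norm_minus_commute)
  then show ?thesis using z by (simp add: stolz_region_def)
qed

section \<open>Affine self-maps of the right half-plane\<close>

lemma affine_half_plane_coefficients:
  assumes pos: "\<And>w. Re w > 0 \<Longrightarrow> Re (A * w + B) > 0"
  obtains a where "A = complex_of_real a" "a \<ge> 0" "Re B \<ge> 0"
proof -
  have *: "Re A * x - Im A * y + Re B > 0" if "x > 0" for x y
    using pos[of "Complex x y"] that by simp
  have "Im A = 0"
  proof (rule ccontr)
    assume "Im A \<noteq> 0"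
    then show False using *[of 1 "(Re A + Re B) / Im A"] by simp
  qed
  with * have **: "Re A * x + Re B > 0" if "x > 0" for x using that[THEN *, of 0] by simp
  have "Re A \<ge> 0"
  proof (rule ccontr)
    assume "\<not> Re A \<ge> 0"
    then have neg: "Re A < 0" by simp
    then have "Re A * ((\<bar>Re B\<bar> + 1) / - Re A) = - (\<bar>Re B\<bar> + 1)" by simp
    moreover have "(\<bar>Re B\<bar> + 1) / - Re A > 0" using neg by (intro divide_pos_pos) auto
    ultimately show False using **[of "(\<bar>Re B\<bar> + 1) / - Re A"] by linarith
  qed
  moreover have "Re B \<ge> 0"
  proof (rule field_le_epsilon)
    fix e :: real assume "e > 0"
    then have "Re A * (e / (Re A + 1)) + Re B > 0" using \<open>Re A \<ge> 0\<close> by (intro **) simp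
    moreover have "Re A * (e / (Re A + 1)) \<le> e"
      using \<open>Re A \<ge> 0\<close> \<open>e > 0\<close> by (simp add: field_simps)
    ultimately show "0 \<le> Re B + e" by simp
  qed
  moreover have "A = complex_of_real (Re A)" using \<open>Im A = 0\<close> by (simp add: complex_eq_iff)
  ultimately show ?thesis using that by blast
qed

lemma affine_orbit:
  fixes w :: "nat \<Rightarrow> 'a::comm_ring_1"
  assumes "\<And>n. w (Suc n) = A * w n + B"
  shows "w n = A ^ n * w 0 + (\<Sum>k<n. A ^ k) * B"
proof (induction n)
  case (Suc n)
  have "(\<Sum>k<Suc n. A ^ k) = 1 + A * (\<Sum>k<n. A ^ k)"
    by (subst sum.lessThan_Suc_shift) (simp add: sum_distrib_left)
  then show ?case by (simp add: assms Suc algebra_simps)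
qed simp

text \<open>
  The orbit moves as \<open>a\<^sup>n w\<^sub>0 + s\<^sub>n B\<close> with \<open>s\<^sub>n = 1 + a + \<dots> + a\<^sup>n\<^sup>-\<^sup>1\<close>.  When \<open>Re B > 0\<close>, both
  summands point into the open half-plane; when \<open>a > 1\<close>, the first one dominates the second.
\<close>

lemma affine_orbit_in_sector:
  fixes a :: real and w :: "nat \<Rightarrow> complex"
  assumes rec: "\<And>n. w (Suc n) = of_real a * w n + B"
    and a: "a \<ge> 1" and B: "Re B \<ge> 0" and w0: "Re (w 0) > 0"
    and nontrivial: "a > 1 \<or> Re B > 0"
  obtains M where "\<And>n. norm (w n + 1) < M * Re (w n)"
proof -
  define s where "s = (\<lambda>n. \<Sum>k<n. a ^ k)"
  have s0: "s n \<ge> 0" for n unfolding s_def using a by (auto intro!: sum_nonneg)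
  have w: "w n = of_real (a ^ n) * w 0 + of_real (s n) * B" for n
    using affine_orbit[of w "of_real a" B n, OF rec] by (simp add: s_def)
  have Re_w: "Re (w n) = a ^ n * Re (w 0) + s n * Re B" for n
    unfolding w[of n] by (simp del: of_real_power)
  have Re_pos: "Re (w n) > 0" for n
    unfolding Re_w[of n] using a w0 s0[of n] B by (intro add_pos_nonneg) auto
  have norm_w: "norm (w n + 1) \<le> a ^ n * (norm (w 0) + 1) + s n * norm B" for n
  proof -
    have "norm (w n + 1) \<le> norm (of_real (a ^ n) * w 0) + norm (of_real (s n) * B) + 1"
      unfolding w[of n] by (smt (verit) norm_triangle_ineq norm_one)
    also have "\<dots> = a ^ n * norm (w 0) + s n * norm B + 1"
      using a s0[of n] by (simp add: norm_mult norm_power)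
    finally show ?thesis using one_le_power[OF a, of n] by (simp add: distrib_left)
  qed
  have "\<exists>K. \<forall>n. norm (w n + 1) \<le> K * Re (w n)"
  proof (cases "Re B > 0")
    case True
    define K where "K = max ((norm (w 0) + 1) / Re (w 0)) (norm B / Re B)"
    have K: "norm (w 0) + 1 \<le> K * Re (w 0)" "norm B \<le> K * Re B"
      using w0 True by (simp_all add: K_def flip: pos_divide_le_eq)
    have "norm (w n + 1) \<le> K * Re (w n)" for n
    proof -
      have "a ^ n * (norm (w 0) + 1) + s n * norm B \<le> a ^ n * (K * Re (w 0)) + s n * (K * Re B)"
        using a s0[of n] K by (intro add_mono mult_left_mono) auto
      also have "\<dots> = K * Re (w n)" by (simp add: Re_w[of n] algebra_simps)
      finally show ?thesis using norm_w[of n] by linarith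
    qed
    then show ?thesis by blast
  next
    case False
    then have a1: "a > 1" and B0: "Re B = 0" using nontrivial B by auto
    define K where "K = (norm (w 0) + 1 + norm B / (a - 1)) / Re (w 0)"
    have "norm (w n + 1) \<le> K * Re (w n)" for n
    proof -
      have "s n = (a ^ n - 1) / (a - 1)" unfolding s_def using a1 by (simp add: geometric_sum)
      also have "\<dots> \<le> a ^ n / (a - 1)" using a1 by (simp add: divide_right_mono)
      finally have "s n * norm B \<le> a ^ n / (a - 1) * norm B" by (rule mult_right_mono) simp
      moreover have "K * Re (w n) = (norm (w 0) + 1 + norm B / (a - 1)) * a ^ n"
        using w0 by (simp add: K_def Re_w[of n] B0)
      then have "K * Re (w n) = a ^ n * (norm (w 0) + 1) + a ^ n / (a - 1) * norm B"
        by (simp add: algebra_simps)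
      ultimately show ?thesis using norm_w[of n] by linarith
    qed
    then show ?thesis by blast
  qed
  then obtain K where K: "\<And>n. norm (w n + 1) \<le> K * Re (w n)" by blast
  have "norm (w n + 1) < (K + 1) * Re (w n)" for n
    using K[of n] Re_pos[of n] by (simp add: algebra_simps)
  then show ?thesis by (rule that)
qed

lemma contracting_affine_orbit_bounded:
  fixes a :: real and w :: "nat \<Rightarrow> complex"
  assumes rec: "\<And>n. w (Suc n) = of_real a * w n + B"
    and a: "0 \<le> a" "a < 1"
  obtains C where "\<And>n. norm (w n) \<le> C"
proof
  fix n
  show "norm (w n) \<le> norm (w 0) + norm B / (1 - a)"
  proof (induction n)
    case 0
    then show ?case using a by simp
  next
    case (Suc n)
    have "norm (w (Suc n)) \<le> a * norm (w n) + norm B"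
      unfolding rec using a norm_triangle_ineq[of "of_real a * w n" B] by (simp add: norm_mult)
    also have "\<dots> \<le> a * (norm (w 0) + norm B / (1 - a)) + norm B"
      using Suc a by (simp add: mult_left_mono)
    also have "\<dots> = a * norm (w 0) + norm B / (1 - a)"
      using a by (simp add: field_simps)
    also have "\<dots> \<le> norm (w 0) + norm B / (1 - a)"
      using a by (simp add: mult_left_le_one_le)
    finally show ?case .
  qed
qed

section \<open>Fixed points on the circle\<close>

text \<open>
  The iterates of a point of the disk tend to \<open>p\<close>, so continuity of the fraction at \<open>p\<close> gives
  \<open>\<phi>(p) = p\<close>; continuity holds because a zero of the denominator at \<open>p\<close> would, the values being
  bounded, also be a zero of the numerator.
\<close>

lemma linear_fractional_boundary_fixed_point:
  assumes p: "norm p = 1" and det: "a * d - b * c \<noteq> 0"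
    and nz: "\<And>z. z \<in> unit_disk \<Longrightarrow> c * z + d \<noteq> 0"
    and \<phi>: "\<And>z. z \<in> unit_disk \<Longrightarrow> \<phi> z = (a * z + b) / (c * z + d)"
    and \<phi>_in: "\<And>z. z \<in> unit_disk \<Longrightarrow> \<phi> z \<in> unit_disk"
    and x: "\<And>n. x n \<in> unit_disk" "\<And>n. x (Suc n) = \<phi> (x n)" "x \<longlonglongrightarrow> p"
  shows "c * p + d \<noteq> 0" and "a * p + b = p * (c * p + d)"
proof -
  have num: "(\<lambda>n. a * x n + b) \<longlonglongrightarrow> a * p + b" and den: "(\<lambda>n. c * x n + d) \<longlonglongrightarrow> c * p + d"
    by (intro tendsto_intros x)+
  have eq: "a * x n + b = x (Suc n) * (c * x n + d)" for n
    using x nz[of "x n"] \<phi>[of "x n"] by simp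
  have "(\<lambda>n. x (Suc n) * (c * x n + d)) \<longlonglongrightarrow> p * (c * p + d)"
    by (intro tendsto_mult den LIMSEQ_Suc x)
  then show fix_p: "a * p + b = p * (c * p + d)"
    using num eq LIMSEQ_unique by simp
  show "c * p + d \<noteq> 0"
  proof
    assume "c * p + d = 0"
    then have "d = - c * p" "b = - a * p" using fix_p by (auto simp: eq_neg_iff_add_eq_0 add.commute)
    then show False using det by simp
  qed
qed

lemma linear_fractional_difference_at_fixed_point:
  fixes a b c d p z :: "'a::field"
  assumes "a * p + b = p * (c * p + d)" "c * z + d \<noteq> 0"
  shows "p - (a * z + b) / (c * z + d) = (a - c * p) * (p - z) / (c * z + d)"
proof -
  have b: "b = p * (c * p + d) - a * p" using assms(1) by (simp add: algebra_simps)
  show ?thesis using assms(2) by (simp add: b divide_simps) (simp add: algebra_simps)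
qed

text \<open>
  In the coordinate \<open>w\<close> the map \<open>\<phi>\<close> fixes infinity, so it is affine, and its linear coefficient is
  the reciprocal of the derivative of \<open>\<phi>\<close> at \<open>p\<close>.
\<close>

lemma boundary_fixed_point_affine:
  assumes p: "norm p = 1" and \<phi>: "linear_fractional_self_map \<phi>"
    and x: "\<And>n. x n \<in> unit_disk" "\<And>n. x (Suc n) = \<phi> (x n)" "x \<longlonglongrightarrow> p"
  obtains a B where "0 \<le> a" "0 \<le> Re B"
    "\<And>z. z \<in> unit_disk \<Longrightarrow> cayley p (\<phi> z) = of_real a * cayley p z + B"
    "has_angular_derivative \<phi> p (1 / of_real a)"
proof -
  obtain a b c d where det: "a * d - b * c \<noteq> 0"
    and nz: "\<And>z. z \<in> unit_disk \<Longrightarrow> c * z + d \<noteq> 0"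
    and eq: "\<And>z. z \<in> unit_disk \<Longrightarrow> \<phi> z = (a * z + b) / (c * z + d)"
    using \<phi> unfolding linear_fractional_self_map_def by metis
  have \<phi>_in: "\<phi> z \<in> unit_disk" if "z \<in> unit_disk" for z
    using \<phi> that unfolding linear_fractional_self_map_def self_map_def by blast
  note fix_p = linear_fractional_boundary_fixed_point[OF p det nz eq \<phi>_in x]
  have p0: "p \<noteq> 0" using p by auto
  have diff: "p - \<phi> z = (a - c * p) * (p - z) / (c * z + d)" if "z \<in> unit_disk" for z
    using linear_fractional_difference_at_fixed_point[OF fix_p(2) nz[OF that]] eq[OF that] by simp
  have acp: "a - c * p \<noteq> 0"
    using diff[of 0] \<phi>_in[of 0] p by auto
  define A where "A = (c * p + d) / (a - c * p)"
  define B where "B = A - 1 - 2 * p * c / (a - c * p)"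
  have aff: "cayley p (\<phi> z) = A * cayley p z + B" if z: "z \<in> unit_disk" for z
  proof -
    have zp: "p - z \<noteq> 0" "z \<noteq> p" "\<phi> z \<noteq> p"
      using unit_disk_neq_boundary[OF p] z \<phi>_in[OF z] by auto
    have "cayley p (\<phi> z) + 1 = 2 * p * (c * z + d) / ((a - c * p) * (p - z))"
      using zp diff[OF z] nz[OF z] by (simp add: cayley_plus_1)
    also have "\<dots> = A * (2 * p / (p - z)) - 2 * p * c / (a - c * p)"
      using zp acp by (simp add: A_def divide_simps) (simp add: algebra_simps)
    also have "\<dots> = A * (cayley p z + 1) - 2 * p * c / (a - c * p)"
      using zp by (simp add: cayley_plus_1)
    finally show ?thesis by (simp add: B_def algebra_simps)
  qed
  have "Re (A * w + B) > 0" if "Re w > 0" for w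
    using cayley_surj[OF p that] aff Re_cayley_pos[OF p \<phi>_in] by metis
  then obtain \<alpha> where \<alpha>: "A = of_real \<alpha>" "\<alpha> \<ge> 0" "Re B \<ge> 0"
    by (rule affine_half_plane_coefficients)
  have p_in: "p \<in> sphere 0 1" using p by simp
  have inv_A: "1 / of_real \<alpha> = (a - c * p) / (c * p + d)"
    by (simp add: A_def flip: \<alpha>(1))
  have "((\<lambda>z. (a * z + b) / (c * z + d)) \<longlongrightarrow> (a * p + b) / (c * p + d)) (at p within T)" for T
    by (intro tendsto_intros fix_p)
  then have lim1: "((\<lambda>z. (a * z + b) / (c * z + d)) \<longlongrightarrow> p) (at p within T)" for T
    using fix_p by simp
  have "has_angular_limit \<phi> p p"
    unfolding has_angular_limit_def
  proof (intro disjI2 conjI allI impI p_in)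
    fix M :: real
    show "(\<phi> \<longlongrightarrow> p) (at p within stolz_region p M)"
      by (rule Lim_transform_eventually[OF lim1])
        (auto simp: eventually_at_filter stolz_region_def eq intro!: always_eventually)
  qed
  moreover have "has_angular_limit (\<lambda>z. (\<phi> z - p) / (z - p)) p (1 / of_real \<alpha>)"
    unfolding has_angular_limit_def
  proof (intro disjI2 conjI allI impI p_in)
    fix M :: real
    have lim2: "((\<lambda>z. (a - c * p) / (c * z + d)) \<longlongrightarrow> 1 / of_real \<alpha>) (at p within stolz_region p M)"
      unfolding inv_A by (intro tendsto_intros fix_p)
    have "(a - c * p) / (c * z + d) = (\<phi> z - p) / (z - p)" if "z \<in> stolz_region p M" for z
    proof -
      have z: "z \<in> unit_disk" using that by (simp add: stolz_region_def)
      have "(\<phi> z - p) / (z - p) = (p - \<phi> z) / (p - z)" by (metis minus_diff_eq minus_divide_divide)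
      then show ?thesis using diff[OF z] unit_disk_neq_boundary[OF p z] by simp
    qed
    then show "((\<lambda>z. (\<phi> z - p) / (z - p)) \<longlongrightarrow> 1 / of_real \<alpha>) (at p within stolz_region p M)"
      by (intro Lim_transform_eventually[OF lim2])
        (auto simp: eventually_at_filter intro!: always_eventually)
  qed
  ultimately have "has_angular_derivative \<phi> p (1 / of_real \<alpha>)"
    unfolding has_angular_derivative_def by blast
  then show ?thesis using that \<alpha> aff by blast
qed

lemma half_plane_translation_automorphism:
  assumes p: "norm p = 1" and \<phi>: "self_map \<phi>" and B: "Re B = 0"
    and transl: "\<And>z. z \<in> unit_disk \<Longrightarrow> cayley p (\<phi> z) = cayley p z + B"
  shows "disk_automorphism \<phi>"
proof -
  have \<phi>_in: "\<phi> ` unit_disk \<subseteq> unit_disk" using \<phi> by (simp add: self_map_def)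
  have "inj_on \<phi> unit_disk"
  proof (rule inj_onI)
    fix x y assume xy: "x \<in> unit_disk" "y \<in> unit_disk" "\<phi> x = \<phi> y"
    then have "cayley p x = cayley p y" using transl by (metis add_right_cancel)
    then show "x = y" by (rule cayley_inj[OF p xy(1,2)])
  qed
  moreover have "unit_disk \<subseteq> \<phi> ` unit_disk"
  proof
    fix y assume y: "y \<in> unit_disk"
    have "Re (cayley p y - B) > 0" using Re_cayley_pos[OF p y] B by simp
    then obtain x where x: "x \<in> unit_disk" "cayley p x = cayley p y - B"
      by (rule cayley_surj[OF p])
    then have "cayley p (\<phi> x) = cayley p y" using transl by simp
    moreover have "\<phi> x \<in> unit_disk" using x \<phi>_in by blast
    ultimately have "\<phi> x = y" using cayley_inj[OF p] y by blast
    then show "y \<in> \<phi> ` unit_disk" using x by blast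
  qed
  ultimately show ?thesis
    using \<phi> \<phi>_in by (auto simp: disk_automorphism_def bij_betw_def)
qed

text \<open>
  An orbit inside a fixed Stolz region forces \<open>f\<close>, which is constant along it, to take the value
  \<open>L\<close> there.  So the orbits in the half-plane must be tangential, which leaves only the vertical
  translations.
\<close>

lemma boundary_denjoy_wolff_parabolic_automorphism:
  assumes \<phi>: "linear_fractional_self_map \<phi>"
    and p: "p \<in> sphere 0 1" "denjoy_wolff_point \<phi> p"
    and L: "has_angular_limit f p L"
    and nonconst: "\<not> f constant_on unit_disk"
    and inv: "\<And>z. z \<in> unit_disk \<Longrightarrow> f (\<phi> z) = f z"
  shows "disk_automorphism \<phi> \<and> parabolic \<phi>"
proof -
  have np: "norm p = 1" and p_out: "p \<notin> unit_disk" using p(1) by auto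
  have self: "self_map \<phi>" using \<phi> by (simp add: linear_fractional_self_map_def)
  have \<phi>_in: "\<phi> z \<in> unit_disk" if "z \<in> unit_disk" for z
    using self that unfolding self_map_def by blast
  have orbit_in: "(\<phi> ^^ n) z \<in> unit_disk" if "z \<in> unit_disk" for z n
    by (induction n) (use that \<phi>_in in simp_all)
  have orbit_lim: "(\<lambda>n. (\<phi> ^^ n) z) \<longlonglongrightarrow> p" if "z \<in> unit_disk" for z
  proof -
    have "uniform_limit {z} (\<lambda>n. \<phi> ^^ n) (\<lambda>_. p) sequentially"
      using p p_out that unfolding denjoy_wolff_point_def
      by (metis compact_sing empty_subsetI insert_subset)
    then show ?thesis by (rule tendsto_uniform_limitI) simp
  qed
  obtain a B where a: "0 \<le> a" and B: "0 \<le> Re B"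
    and aff: "\<And>z. z \<in> unit_disk \<Longrightarrow> cayley p (\<phi> z) = of_real a * cayley p z + B"
    and der: "has_angular_derivative \<phi> p (1 / of_real a)"
    using boundary_fixed_point_affine[OF np \<phi>, of "\<lambda>n. (\<phi> ^^ n) 0"] orbit_in[of 0] orbit_lim[of 0]
    by auto
  define w where "w = (\<lambda>z n. cayley p ((\<phi> ^^ n) z))"
  have rec: "w z (Suc n) = of_real a * w z n + B" if "z \<in> unit_disk" for z n
    using aff[OF orbit_in[OF that]] by (simp add: w_def)
  have "a \<ge> 1"
  proof (rule ccontr)
    assume "\<not> a \<ge> 1"
    then obtain C where C: "\<And>n. norm (w 0 n) \<le> C"
      using contracting_affine_orbit_bounded[of "w 0" a B] rec[of 0] a by auto
    \<comment> \<open>The product below equals \<open>2 p\<close> but tends to 0.\<close>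
    have "(\<lambda>n. p - (\<phi> ^^ n) 0) \<longlonglongrightarrow> 0"
      using tendsto_diff[OF tendsto_const[of p] orbit_lim[of 0]] by simp
    moreover have "norm (w 0 n + 1) \<le> C + 1" for n
      using C[of n] norm_triangle_ineq[of "w 0 n" 1] by simp
    ultimately have "(\<lambda>n. (p - (\<phi> ^^ n) 0) * (w 0 n + 1)) \<longlonglongrightarrow> 0"
      by (intro lim_null_mult_right_bounded[where B = "C + 1"]) auto
    moreover have "(p - (\<phi> ^^ n) 0) * (w 0 n + 1) = 2 * p" for n
    proof -
      have "(\<phi> ^^ n) 0 \<noteq> p" using unit_disk_neq_boundary[OF np orbit_in[of 0 n]] by simp
      then show ?thesis by (simp add: w_def cayley_plus_1)
    qed
    ultimately have "2 * p = 0" using LIMSEQ_unique[OF tendsto_const] by auto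
    then show False using np by auto
  qed
  have not_sector: "\<not> (a > 1 \<or> Re B > 0)"
  proof
    assume escape: "a > 1 \<or> Re B > 0"
    have "f z = L" if z: "z \<in> unit_disk" for z
    proof -
      have "Re (w z 0) > 0" using Re_cayley_pos[OF np z] by (simp add: w_def)
      then obtain M where M: "\<And>n. norm (w z n + 1) < M * Re (w z n)"
        using affine_orbit_in_sector[of "w z" a B] rec[OF z] \<open>a \<ge> 1\<close> B escape by blast
      \<comment> \<open>Angular limits are taken in Stolz regions of aperture greater than 1, hence the maximum.\<close>
      have stolz: "(\<phi> ^^ n) z \<in> stolz_region p (max M 2)" for n
      proof -
        have "(\<phi> ^^ n) z \<in> stolz_region p M"
          using sector_imp_stolz[OF np orbit_in[OF z]] M[of n] by (simp add: w_def)
        moreover have "M * (1 - norm ((\<phi> ^^ n) z)) \<le> max M 2 * (1 - norm ((\<phi> ^^ n) z))"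
          using orbit_in[OF z, of n] by (intro mult_right_mono) auto
        ultimately show ?thesis
          unfolding stolz_region_def mem_Collect_eq by (meson order.strict_trans2)
      qed
      have "(\<lambda>n. f ((\<phi> ^^ n) z)) \<longlonglongrightarrow> L"
      proof (rule filterlim_compose[of f])
        show "(f \<longlongrightarrow> L) (at p within stolz_region p (max M 2))"
          using L p_out by (auto simp: has_angular_limit_def)
        show "filterlim (\<lambda>n. (\<phi> ^^ n) z) (at p within stolz_region p (max M 2)) sequentially"
          unfolding filterlim_at using orbit_lim[OF z] stolz orbit_in[OF z] p_out
          by (auto intro!: always_eventually)
      qed
      moreover have "f ((\<phi> ^^ n) z) = f z" for n
        by (induction n) (use inv orbit_in[OF z] in auto)
      ultimately show ?thesis using LIMSEQ_unique[OF tendsto_const] by auto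
    qed
    then show False using nonconst by (auto simp: constant_on_def)
  qed
  have a1: "a = 1" and B0: "Re B = 0" using not_sector \<open>a \<ge> 1\<close> B by auto
  have "disk_automorphism \<phi>"
    using half_plane_translation_automorphism[OF np self B0] aff a1 by simp
  moreover have "parabolic \<phi>"
    using der p a1 by (auto simp: parabolic_def)
  ultimately show ?thesis by blast
qed

section \<open>The intertwining equation\<close>

lemma identity_on_image_imp_identity:
  assumes f: "f holomorphic_on S" "\<not> f constant_on S" "f ` S \<subseteq> T"
    and S: "open S" "connected S" and T: "open T" "connected T"
    and g: "g holomorphic_on T"
    and fixed: "\<And>z. z \<in> S \<Longrightarrow> g (f z) = f z"
    and z: "z \<in> T"
  shows "g z = z"
proof -
  have "open (f ` S)" using open_mapping_thm[OF f(1) S S(1) order_refl f(2)] .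
  moreover have "S \<noteq> {}" using f(2) by (auto simp: constant_on_def)
  ultimately show ?thesis
    using analytic_continuation_open[of "f ` S" T g "\<lambda>z. z"] T g f(3) fixed z
    by (auto simp: holomorphic_on_ident)
qed

theorem theorem2:
  fixes \<phi> \<psi> f :: "complex \<Rightarrow> complex"
  assumes "linear_fractional_self_map \<phi>"
    and "linear_fractional_self_map \<psi>"
    and "self_map f"
    and "\<not> f constant_on unit_disk"
    and "\<forall>z\<in>unit_disk. (f \<circ> \<phi>) z = (\<psi> \<circ> f) z"
  shows "(id_on_disk \<phi> \<longrightarrow> id_on_disk \<psi>) \<and>
         (\<forall>p. id_on_disk \<psi> \<and> \<not> id_on_disk \<phi> \<and> denjoy_wolff_point \<phi> p \<and>
              (\<exists>L. has_angular_limit f p L) \<longrightarrow>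
            rational_elliptic_automorphism \<phi> \<or> (disk_automorphism \<phi> \<and> parabolic \<phi>))"
proof (intro conjI impI allI)
  have f: "f holomorphic_on unit_disk" "f ` unit_disk \<subseteq> unit_disk"
    and \<psi>: "\<psi> holomorphic_on unit_disk" and \<phi>: "self_map \<phi>"
    using assms(1-3) by (auto simp: self_map_def linear_fractional_self_map_def)
  show "id_on_disk \<psi>" if "id_on_disk \<phi>"
    using identity_on_image_imp_identity[OF f(1) assms(4) f(2) _ _ _ _ \<psi>] assms(5) that
    by (auto simp: convex_connected)
  fix p
  assume asm: "id_on_disk \<psi> \<and> \<not> id_on_disk \<phi> \<and> denjoy_wolff_point \<phi> p \<and>
    (\<exists>L. has_angular_limit f p L)"
  have inv: "f (\<phi> z) = f z" if "z \<in> unit_disk" for z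
  proof -
    have "f z \<in> unit_disk" using f(2) that by blast
    then show ?thesis using assms(5) asm that by simp
  qed
  show "rational_elliptic_automorphism \<phi> \<or> (disk_automorphism \<phi> \<and> parabolic \<phi>)"
  proof (cases "\<exists>z\<in>unit_disk. \<phi> z = z")
    case True
    then have "p \<in> unit_disk" "\<phi> p = p" using asm by (auto simp: denjoy_wolff_point_def)
    then show ?thesis
      using interior_fixed_point_rational_elliptic[OF \<phi> _ _ _ f(1) assms(4)] inv asm by blast
  next
    case False
    then have "p \<in> sphere 0 1" using asm by (auto simp: denjoy_wolff_point_def)
    then show ?thesis
      using boundary_denjoy_wolff_parabolic_automorphism[OF assms(1) _ _ _ assms(4)] inv asm
      by blast
  qed
qed

end
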